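(* Let $Q$ be a probability measure on $(\Omega,\mathcal{F})$ equivalent to $P$. The following assertions are equivalent: (1) There are probability measures $Q_1,\dots,Q_d$ on $(\Omega,\mathcal{F})$ with $Q_i\ll Q$ for all $1\le i\le d$ and $$\frac{dQ_{i|\mathcal{F}_t}}{dQ_{|\mathcal{F}_t}}=\frac{X^i_t}{X^i_0}\quad (Q\text{-a.s.}),\qquad t\in I,\ 1\le i\le d.$$ (2) $Q$ is a martingale measure, i.e. $(X^i_t)_{t\in I}$ is a $Q$-martingale with respect to $(\mathcal{F}_t)_{t\in I}$ for each $1\le i\le d$.
   Context: Fix $0<T<\infty$, a set $I\subset[0,T]$ with $\{0,T\}\subset I$, and a probability space $(\Omega,\mathcal{F},P)$ with a filtration $(\mathcal{F}_t)_{t\in I}$ such that $\mathcal{F}=\sigma(\mathcal{F}_t:t\in I)$ and $\mathcal{F}_0=\sigma(\mathcal{N})$, where $\mathcal{N}=\{N\in\mathcal{F}:P(N)=0\text{ or }P(N)=1\}$. Let $(X^i_t)_{t\in I}$, $1\le i\le d$, be adapted, (strictly) positive real-valued processes (discounted price processes). $Q_{|\mathcal{F}_t}$ denotes the restriction of $Q$ to $\mathcal{F}_t$. *)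

theory Defs
  imports "HOL-Probability.Probability"
begin

text \<open>The library locale \<^locale>\<open>filtration\<close> is indexed by a whole type; here the time set is an
  arbitrary set of reals. The measures carried by \<open>F t\<close> are irrelevant, only the
  \<open>\<sigma>\<close>-algebras \<open>sets (F t)\<close> are used.\<close>

definition filtration_on :: "real set \<Rightarrow> 'a measure \<Rightarrow> (real \<Rightarrow> 'a measure) \<Rightarrow> bool" where
  "filtration_on I M F \<longleftrightarrow>
     (\<forall>t\<in>I. subalgebra M (F t)) \<and>
     (\<forall>s\<in>I. \<forall>t\<in>I. s \<le> t \<longrightarrow> sets (F s) \<subseteq> sets (F t))"

definition adapted_on :: "real set \<Rightarrow> (real \<Rightarrow> 'a measure) \<Rightarrow> (real \<Rightarrow> 'a \<Rightarrow> real) \<Rightarrow> bool" where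
  "adapted_on I F Y \<longleftrightarrow> (\<forall>t\<in>I. Y t \<in> borel_measurable (F t))"

definition trivial_events :: "'a measure \<Rightarrow> 'a set set" where
  "trivial_events M = {N \<in> sets M. emeasure M N = 0 \<or> emeasure M N = 1}"

definition equivalent_measures :: "'a measure \<Rightarrow> 'a measure \<Rightarrow> bool" where
  "equivalent_measures M N \<longleftrightarrow>
     sets M = sets N \<and> absolutely_continuous M N \<and> absolutely_continuous N M"

definition martingale_on ::
  "'a measure \<Rightarrow> real set \<Rightarrow> (real \<Rightarrow> 'a measure) \<Rightarrow> (real \<Rightarrow> 'a \<Rightarrow> real) \<Rightarrow> bool" where
  "martingale_on M I F Y \<longleftrightarrow>
     adapted_on I F Y \<and>
     (\<forall>t\<in>I. integrable M (Y t)) \<and>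
     (\<forall>s\<in>I. \<forall>t\<in>I. s \<le> t \<longrightarrow> (AE \<omega> in M. real_cond_exp M (F s) (Y t) \<omega> = Y s \<omega>))"

definition martingale_measure ::
  "'a measure \<Rightarrow> real set \<Rightarrow> (real \<Rightarrow> 'a measure) \<Rightarrow> nat \<Rightarrow> (nat \<Rightarrow> real \<Rightarrow> 'a \<Rightarrow> real) \<Rightarrow> bool" where
  "martingale_measure M I F d X \<longleftrightarrow> (\<forall>i\<in>{1..d}. martingale_on M I F (X i))"

end

theory Submission
  imports Defs
begin

text \<open>
  The Radon-Nikodym derivative of \<open>Q\<^sub>i\<close> with respect to \<open>Q\<close> on \<open>\<F>\<^sub>t\<close> is the nonnegative
  \<open>\<F>\<^sub>t\<close>-measurable function whose \<open>Q\<close>-integral over every event \<open>A \<in> \<F>\<^sub>t\<close> is \<open>Q\<^sub>i(A)\<close>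
  (\<open>RN_deriv_restr_to_subalg_AE_eq_iff\<close>), and the conditional expectation given \<open>\<F>\<^sub>s\<close> is likewise
  determined by integrals over the events of \<open>\<F>\<^sub>s\<close> (\<open>real_cond_exp_AE_eq_iff_nn_integral\<close>).
  Hence the density process \<open>Z\<close> of any \<open>Q\<^sub>i \<lless> Q\<close> is a martingale: for \<open>s \<le> t\<close> and \<open>A \<in> \<F>\<^sub>s\<close> the
  integrals of \<open>Z\<^sub>s\<close> and of \<open>Z\<^sub>t\<close> over \<open>A\<close> are both \<open>Q\<^sub>i(A)\<close>. Conversely, if \<open>Z\<close> is a nonnegative
  martingale with \<open>Z\<^sub>0 = 1\<close>, then the measure with \<open>Q\<close>-density \<open>Z\<^sub>T\<close> at the terminal time has
  total mass one, and its density on \<open>\<F>\<^sub>t\<close> is \<open>Z\<^sub>t\<close> by the martingale property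
  (\<open>ex_measure_with_density_process_iff_martingale\<close>).

  This applies to \<open>Z = X\<^sup>i / X\<^sup>i\<^sub>0\<close>. Since \<open>\<F>\<^sub>0\<close> contains only events of probability zero or one,
  under \<open>P\<close> and therefore under \<open>Q\<close>, \<open>X\<^sup>i\<^sub>0\<close> is almost surely a positive constant
  (\<open>AE_eq_const_if_zero_one\<close>), so that \<open>X\<^sup>i\<close> and \<open>X\<^sup>i / X\<^sup>i\<^sub>0\<close> are martingales simultaneously (\<open>martingale_on_AE_eq_cmult\<close>).
\<close>

section \<open>Zero-one sigma-algebras\<close>

text \<open>Absolute continuity of \<open>Q\<close> with respect to \<open>P\<close> carries almost sure statements from \<open>P\<close> to
  \<open>Q\<close>, hence the dichotomy for the generating events. The dichotomy passes to countable
  unions because either one member is almost sure, or all members are null.\<close>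

lemma AE_zero_one_sigma_sets_trivial_events:
  assumes P: "prob_space P" and ac: "absolutely_continuous P Q" and sp: "sets Q = sets P"
    and A: "A \<in> sigma_sets (space P) (trivial_events P)"
  shows "(AE x in Q. x \<in> A) \<or> (AE x in Q. x \<notin> A)"
  using A
proof (induction rule: sigma_sets.induct)
  case (Basic N)
  then have N: "N \<in> sets P" and "emeasure P N = 0 \<or> emeasure P N = 1"
    by (auto simp: trivial_events_def)
  then have "(AE x in P. x \<in> N) \<or> (AE x in P. x \<notin> N)"
    using prob_space.AE_in_set_eq_1[OF P N] AE_not_in[of N P]
    by (auto simp: null_sets_def prob_space.emeasure_eq_1_AE[OF P] measure_def)
  then show ?case
    using absolutely_continuous_AE[OF sp ac] by blast
next
  case Empty
  then show ?case by simp
next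
  case (Compl A)
  have "AE x in Q. x \<in> space P"
    using AE_space[of Q] by (simp add: sets_eq_imp_space_eq[OF sp])
  from Compl.IH show ?case
  proof
    assume "AE x in Q. x \<in> A"
    then have "AE x in Q. x \<notin> space P - A"
      by (rule eventually_mono) simp
    then show ?thesis ..
  next
    assume "AE x in Q. x \<notin> A"
    with \<open>AE x in Q. x \<in> space P\<close> have "AE x in Q. x \<in> space P - A"
      by eventually_elim simp
    then show ?thesis ..
  qed
next
  case (Union A)
  show ?case
  proof (cases "\<exists>i. AE x in Q. x \<in> A i")
    case True
    then obtain i where "AE x in Q. x \<in> A i" ..
    then have "AE x in Q. x \<in> (\<Union>i. A i)"
      by (rule eventually_mono) auto
    then show ?thesis ..
  next
    case False
    then have "\<forall>i. AE x in Q. x \<notin> A i"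
      using Union.IH by blast
    then show ?thesis
      by (auto simp: AE_all_countable[symmetric])
  qed
qed

text \<open>A real number is determined by the rational numbers above it, and each of the countably many
  events \<open>{Y \<le> q}\<close> is either almost sure or null.\<close>

lemma AE_eq_const_if_zero_one:
  fixes Y :: "'a \<Rightarrow> real"
  assumes M: "prob_space M" and sub: "subalgebra M F" and Y: "Y \<in> borel_measurable F"
    and zero_one: "\<And>A. A \<in> sets F \<Longrightarrow> (AE x in M. x \<in> A) \<or> (AE x in M. x \<notin> A)"
  shows "\<exists>x0\<in>space M. AE x in M. Y x = Y x0"
proof -
  have "\<exists>b. AE x in M. (Y x \<le> of_rat q) = b" for q :: rat
  proof -
    have "{x \<in> space F. Y x \<le> of_rat q} \<in> sets F"
      using Y by measurable
    from zero_one[OF this] show ?thesis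
    proof
      assume "AE x in M. x \<in> {x \<in> space F. Y x \<le> of_rat q}"
      then have "AE x in M. (Y x \<le> of_rat q) = True"
        by (rule eventually_mono) auto
      then show ?thesis ..
    next
      assume "AE x in M. x \<notin> {x \<in> space F. Y x \<le> of_rat q}"
      then have "AE x in M. (Y x \<le> of_rat q) = False"
        using AE_space[of M] sub by (auto simp: subalgebra_def elim: eventually_elim2)
      then show ?thesis ..
    qed
  qed
  then obtain b where "\<And>q :: rat. AE x in M. (Y x \<le> of_rat q) = b q"
    by metis
  then have all: "AE x in M. \<forall>q :: rat. (Y x \<le> of_rat q) = b q"
    by (simp add: AE_all_countable)
  have "\<exists>x0\<in>space M. \<forall>q :: rat. (Y x0 \<le> of_rat q) = b q"
  proof (rule ccontr)
    assume none: "\<not> ?thesis"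
    from all AE_space[of M] have "AE x in M. False"
      by eventually_elim (use none in blast)
    then show False
      using prob_space.AE_False[OF M] by simp
  qed
  then obtain x0 where x0: "x0 \<in> space M" "\<And>q :: rat. (Y x0 \<le> of_rat q) = b q"
    by blast
  from all have "AE x in M. Y x = Y x0"
  proof eventually_elim
    case (elim x)
    have eq: "Y x \<le> of_rat q \<longleftrightarrow> Y x0 \<le> of_rat q" for q :: rat
      using elim x0(2) by simp
    have "\<not> Y x < Y x0"
      using of_rat_dense[of "Y x" "Y x0"] eq by (metis less_imp_le not_le)
    moreover have "\<not> Y x0 < Y x"
      using of_rat_dense[of "Y x0" "Y x"] eq by (metis less_imp_le not_le)
    ultimately show ?case by simp
  qed
  with x0(1) show ?thesis by blast
qed

section \<open>Densities and conditional expectations through integrals over events\<close>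

text \<open>Because \<open>f\<close> is \<open>F\<close>-measurable, the set where it differs from the derivative lies in \<open>F\<close>, so
  almost sure equality means the same for \<open>M\<close> and for its restriction. On the restriction, both
  sides say that \<open>f\<close> is the density of \<open>N\<close>.\<close>

lemma RN_deriv_restr_to_subalg_AE_eq_iff:
  assumes M: "finite_measure M" and sub: "subalgebra M F"
    and N: "sets N = sets M" "absolutely_continuous M N"
    and f: "f \<in> borel_measurable F"
  shows "(AE x in M. RN_deriv (restr_to_subalg M F) (restr_to_subalg N F) x = f x) \<longleftrightarrow>
    (\<forall>A\<in>sets F. emeasure N A = (\<integral>\<^sup>+x\<in>A. f x \<partial>M))" (is "?ae \<longleftrightarrow> ?int")
proof -
  let ?M = "restr_to_subalg M F" and ?N = "restr_to_subalg N F"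
  have subN: "subalgebra N F"
    using sub N(1) sets_eq_imp_space_eq[OF N(1)] by (simp add: subalgebra_def)
  have sets: "sets ?M = sets F" "sets ?N = sets F"
    using sub subN by (simp_all add: sets_restr_to_subalg)
  interpret R: finite_measure ?M
    using M sub by (rule finite_measure_restr_to_subalg[rotated])
  have fR: "f \<in> borel_measurable ?M"
    using f sub by (rule measurable_in_subalg[rotated])
  have ac: "absolutely_continuous ?M ?N"
    using N(2) by (auto simp: absolutely_continuous_def null_sets_restr_to_subalg sub subN)
  have int: "?int \<longleftrightarrow> density ?M f = ?N"
  proof -
    have "emeasure (density ?M f) A = (\<integral>\<^sup>+x\<in>A. f x \<partial>M)" "emeasure ?N A = emeasure N A"
      if "A \<in> sets F" for A
    proof -
      have "(\<lambda>x. f x * indicator A x) \<in> borel_measurable F"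
        using f that by measurable
      then show "emeasure (density ?M f) A = (\<integral>\<^sup>+x\<in>A. f x \<partial>M)"
        using that fR by (simp add: emeasure_density sets nn_integral_subalgebra2[OF sub])
      show "emeasure ?N A = emeasure N A"
        using that by (rule emeasure_restr_to_subalg[OF subN])
    qed
    then show ?thesis
      by (auto simp: sets intro!: measure_eqI)
  qed
  have "?ae \<longleftrightarrow> (AE x in ?M. RN_deriv ?M ?N x = f x)"
  proof
    assume ?ae
    moreover have "RN_deriv ?M ?N \<in> borel_measurable F"
      using sub by (rule measurable_in_subalg') simp
    then have "Measurable.pred F (\<lambda>x. RN_deriv ?M ?N x = f x)"
      using f by measurable
    ultimately show "AE x in ?M. RN_deriv ?M ?N x = f x"
      by (intro AE_restr_to_subalg2[OF sub])
  qed (rule AE_restr_to_subalg[OF sub])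
  also have "\<dots> \<longleftrightarrow> density ?M f = ?N"
  proof
    assume "AE x in ?M. RN_deriv ?M ?N x = f x"
    then have "density ?M (RN_deriv ?M ?N) = density ?M f"
      by (intro density_cong) (use fR in auto)
    then show "density ?M f = ?N"
      using R.density_RN_deriv[OF ac] sets by simp
  next
    assume "density ?M f = ?N"
    then show "AE x in ?M. RN_deriv ?M ?N x = f x"
      using R.RN_deriv_unique[OF fR] by (auto elim: eventually_mono)
  qed
  finally show ?thesis
    using int by simp
qed

text \<open>Stated with nonnegative integrals, so that it can be combined with densities, whose set
  integrals are measures of events.\<close>

lemma real_cond_exp_AE_eq_iff_nn_integral:
  fixes Y Z :: "'a \<Rightarrow> real"
  assumes M: "finite_measure M" and sub: "subalgebra M F"
    and Y: "integrable M Y" "\<And>x. x \<in> space M \<Longrightarrow> 0 \<le> Y x"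
    and Z: "integrable M Z" "\<And>x. x \<in> space M \<Longrightarrow> 0 \<le> Z x" "Z \<in> borel_measurable F"
  shows "(AE x in M. real_cond_exp M F Y x = Z x) \<longleftrightarrow>
    (\<forall>A\<in>sets F. (\<integral>\<^sup>+x\<in>A. ennreal (Y x) \<partial>M) = (\<integral>\<^sup>+x\<in>A. ennreal (Z x) \<partial>M))"
proof -
  interpret sigma_finite_subalgebra M F
    using M sub by (intro finite_measure_subalgebra_is_sigma_finite)
      (simp add: finite_measure_subalgebra_def finite_measure_subalgebra_axioms_def)
  have nn: "(\<integral>\<^sup>+x\<in>A. ennreal (W x) \<partial>M) = ennreal (\<integral>x\<in>A. W x \<partial>M)"
    and pos: "0 \<le> (\<integral>x\<in>A. W x \<partial>M)"
    if "A \<in> sets F" "integrable M W" "\<And>x. x \<in> space M \<Longrightarrow> 0 \<le> W x" for A and W :: "'a \<Rightarrow> real"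
  proof -
    have "A \<in> sets M"
      using that(1) sub by (auto simp: subalgebra_def)
    then have "integrable M (\<lambda>x. indicator A x * W x)"
      using integrable_mult_indicator[OF _ that(2), of A] by simp
    then show "(\<integral>\<^sup>+x\<in>A. ennreal (W x) \<partial>M) = ennreal (\<integral>x\<in>A. W x \<partial>M)"
      using that(3)
      by (subst nn_integral_set_ennreal)
        (auto simp: set_lebesgue_integral_def mult.commute intro!: nn_integral_eq_integral)
    show "0 \<le> (\<integral>x\<in>A. W x \<partial>M)"
      using that(3) unfolding set_lebesgue_integral_def
      by (intro integral_nonneg_AE) auto
  qed
  have "(AE x in M. real_cond_exp M F Y x = Z x) \<longleftrightarrow>
    (\<forall>A\<in>sets F. (\<integral>x\<in>A. Y x \<partial>M) = (\<integral>x\<in>A. Z x \<partial>M))"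
  proof
    assume ae: "AE x in M. real_cond_exp M F Y x = Z x"
    have "(\<integral>x\<in>A. Y x \<partial>M) = (\<integral>x\<in>A. Z x \<partial>M)" if A: "A \<in> sets F" for A
    proof -
      have [measurable]: "A \<in> sets M" "Z \<in> borel_measurable M"
        using A sub Z(1) by (auto simp: subalgebra_def)
      have "(\<integral>x\<in>A. Y x \<partial>M) = (\<integral>x\<in>A. real_cond_exp M F Y x \<partial>M)"
        using Y(1) A by (rule real_cond_exp_intA)
      also have "\<dots> = (\<integral>x\<in>A. Z x \<partial>M)"
        unfolding set_lebesgue_integral_def
        by (rule integral_cong_AE) (use ae in \<open>auto elim: eventually_mono\<close>)
      finally show ?thesis .
    qed
    then show "\<forall>A\<in>sets F. (\<integral>x\<in>A. Y x \<partial>M) = (\<integral>x\<in>A. Z x \<partial>M)"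
      by blast
  next
    assume "\<forall>A\<in>sets F. (\<integral>x\<in>A. Y x \<partial>M) = (\<integral>x\<in>A. Z x \<partial>M)"
    then show "AE x in M. real_cond_exp M F Y x = Z x"
      using Y(1) Z(1,3) by (intro real_cond_exp_charact) auto
  qed
  also have "\<dots> \<longleftrightarrow>
    (\<forall>A\<in>sets F. (\<integral>\<^sup>+x\<in>A. ennreal (Y x) \<partial>M) = (\<integral>\<^sup>+x\<in>A. ennreal (Z x) \<partial>M))"
    using Y Z by (intro ball_cong refl) (simp add: nn pos)
  finally show ?thesis .
qed

section \<open>Density processes are the normalised nonnegative martingales\<close>

text \<open>The equality is required only almost surely because the initial value of a price process is
  constant only almost surely.\<close>

lemma martingale_on_AE_eq_cmult:
  assumes M: "finite_measure M" and filt: "filtration_on I M F"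
    and Z: "martingale_on M I F Z" and Y: "adapted_on I F Y"
    and eq: "\<And>t. t \<in> I \<Longrightarrow> AE x in M. Y t x = c * Z t x"
  shows "martingale_on M I F Y"
proof -
  have sub: "subalgebra M (F t)" if "t \<in> I" for t
    using filt that by (simp add: filtration_on_def)
  have Zint: "integrable M (Z t)" if "t \<in> I" for t
    using Z that by (simp add: martingale_on_def)
  have Ym: "Y t \<in> borel_measurable M" if "t \<in> I" for t
    using Y that measurable_from_subalg[OF sub] by (auto simp: adapted_on_def)
  have cZm: "(\<lambda>x. c * Z t x) \<in> borel_measurable M" if "t \<in> I" for t
    using Zint[OF that] by measurable
  have "integrable M (Y t)" if "t \<in> I" for t
    using integrable_cong_AE[OF Ym[OF that] cZm[OF that] eq[OF that]] Zint[OF that] by simp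
  moreover have "AE x in M. real_cond_exp M (F s) (Y t) x = Y s x"
    if s: "s \<in> I" and t: "t \<in> I" and st: "s \<le> t" for s t
  proof -
    interpret sigma_finite_subalgebra M "F s"
      using M sub[OF s] by (intro finite_measure_subalgebra_is_sigma_finite)
        (simp add: finite_measure_subalgebra_def finite_measure_subalgebra_axioms_def)
    have "AE x in M. real_cond_exp M (F s) (Z t) x = Z s x"
      using Z s t st by (simp add: martingale_on_def)
    then show ?thesis
      using real_cond_exp_cong[OF eq[OF t] Ym[OF t] cZm[OF t]]
        real_cond_exp_cmult[OF Zint[OF t], of c] eq[OF s]
      by eventually_elim simp
  qed
  ultimately show ?thesis
    using Y by (simp add: martingale_on_def)
qed

text \<open>The normalisation at the least time \<open>a\<close> gives the constructed measure total mass one. The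
  greatest time \<open>b\<close> provides a single density that induces all the \<open>Z\<^sub>t\<close>; a nonnegative martingale
  that is not closed by a last element need not come from one measure \<open>N \<lless> M\<close>.\<close>

lemma ex_measure_with_density_process_iff_martingale:
  assumes M: "prob_space M" and filt: "filtration_on I M F"
    and a: "a \<in> I" and b: "b \<in> I" and ab: "\<And>t. t \<in> I \<Longrightarrow> a \<le> t \<and> t \<le> b"
    and adapt: "adapted_on I F Z"
    and nonneg: "\<And>t x. t \<in> I \<Longrightarrow> x \<in> space M \<Longrightarrow> 0 \<le> Z t x"
    and init: "AE x in M. Z a x = 1"
  shows "(\<exists>N. prob_space N \<and> sets N = sets M \<and> absolutely_continuous M N \<and>
      (\<forall>t\<in>I. AE x in M. RN_deriv (restr_to_subalg M (F t)) (restr_to_subalg N (F t)) x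
        = ennreal (Z t x)))
    \<longleftrightarrow> martingale_on M I F Z" (is "(\<exists>N. ?density N) \<longleftrightarrow> _")
proof -
  interpret M: prob_space M by fact
  have fin: "finite_measure M" by unfold_locales
  have sub: "subalgebra M (F t)" if "t \<in> I" for t
    using filt that by (simp add: filtration_on_def)
  have mono: "A \<in> sets (F t)" if "A \<in> sets (F s)" "s \<in> I" "t \<in> I" "s \<le> t" for A s t
    using filt that by (auto simp: filtration_on_def)
  have space: "space M \<in> sets (F t)" if "t \<in> I" for t
    using sub[OF that] by (metis sets.top subalgebra_def)
  have ZF: "Z t \<in> borel_measurable (F t)" if "t \<in> I" for t
    using adapt that by (simp add: adapted_on_def)
  then have ZF': "(\<lambda>x. ennreal (Z t x)) \<in> borel_measurable (F t)" if "t \<in> I" for t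
    using that by measurable
  have ZM: "Z t \<in> borel_measurable M" if "t \<in> I" for t
    using measurable_from_subalg[OF sub ZF] that by blast
  have total: "(\<integral>\<^sup>+x\<in>space M. g x \<partial>M) = (\<integral>\<^sup>+x. g x \<partial>M)" for g
    by (rule nn_integral_cong) simp
  show ?thesis
  proof
    assume "\<exists>N. ?density N"
    then obtain N where N: "prob_space N" "sets N = sets M" "absolutely_continuous M N"
      and dens: "\<And>t. t \<in> I \<Longrightarrow> AE x in M.
        RN_deriv (restr_to_subalg M (F t)) (restr_to_subalg N (F t)) x = ennreal (Z t x)"
      by blast
    have NA: "emeasure N A = (\<integral>\<^sup>+x\<in>A. ennreal (Z t x) \<partial>M)" if "t \<in> I" "A \<in> sets (F t)" for t A
      using RN_deriv_restr_to_subalg_AE_eq_iff[OF fin sub[OF that(1)] N(2,3) ZF'[OF that(1)]]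
        dens[OF that(1)] that(2) by blast
    have int: "integrable M (Z t)" if t: "t \<in> I" for t
    proof (rule integrableI_nonneg)
      have "(\<integral>\<^sup>+x. ennreal (Z t x) \<partial>M) = emeasure N (space N)"
        using NA[OF t space[OF t]] sets_eq_imp_space_eq[OF N(2)] by (simp add: total)
      then show "(\<integral>\<^sup>+x. ennreal (Z t x) \<partial>M) < \<infinity>"
        using prob_space.emeasure_space_1[OF N(1)] by simp
    qed (use t ZM nonneg in auto)
    have "AE x in M. real_cond_exp M (F s) (Z t) x = Z s x"
      if st: "s \<in> I" "t \<in> I" "s \<le> t" for s t
    proof (subst real_cond_exp_AE_eq_iff_nn_integral[OF fin sub])
      show "\<forall>A\<in>sets (F s). (\<integral>\<^sup>+x\<in>A. ennreal (Z t x) \<partial>M) = (\<integral>\<^sup>+x\<in>A. ennreal (Z s x) \<partial>M)"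
        using NA st mono by metis
    qed (use st int nonneg ZF in auto)
    then show "martingale_on M I F Z"
      using adapt int by (simp add: martingale_on_def)
  next
    assume mart: "martingale_on M I F Z"
    have int: "integrable M (Z t)" if "t \<in> I" for t
      using mart that by (simp add: martingale_on_def)
    have Zb: "(\<integral>\<^sup>+x\<in>A. ennreal (Z b x) \<partial>M) = (\<integral>\<^sup>+x\<in>A. ennreal (Z t x) \<partial>M)"
      if t: "t \<in> I" and A: "A \<in> sets (F t)" for t A
    proof -
      have "AE x in M. real_cond_exp M (F t) (Z b) x = Z t x"
        using mart t b ab by (simp add: martingale_on_def)
      then show ?thesis
        using real_cond_exp_AE_eq_iff_nn_integral[OF fin sub[OF t] int[OF b] nonneg[OF b]
            int[OF t] nonneg[OF t] ZF[OF t]] A by blast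
    qed
    define N where "N = density M (\<lambda>x. ennreal (Z b x))"
    have NA: "emeasure N A = (\<integral>\<^sup>+x\<in>A. ennreal (Z b x) \<partial>M)" if "A \<in> sets M" for A
      unfolding N_def using that ZM[OF b] by (intro emeasure_density) auto
    have setsN: "sets N = sets M"
      by (simp add: N_def)
    have acN: "absolutely_continuous M N"
      unfolding N_def by (rule absolutely_continuousI_density) (use ZM[OF b] in measurable)
    have "prob_space N"
    proof
      have "emeasure N (space N) = (\<integral>\<^sup>+x. ennreal (Z a x) \<partial>M)"
        using NA[OF sets.top] Zb[OF a space[OF a]] by (simp add: N_def total)
      also have "\<dots> = (\<integral>\<^sup>+x. 1 \<partial>M)"
        by (rule nn_integral_cong_AE) (use init in \<open>auto elim: eventually_mono\<close>)
      finally show "emeasure N (space N) = 1"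
        by (simp add: M.emeasure_space_1)
    qed
    moreover have "AE x in M.
        RN_deriv (restr_to_subalg M (F t)) (restr_to_subalg N (F t)) x = ennreal (Z t x)"
      if t: "t \<in> I" for t
    proof (subst RN_deriv_restr_to_subalg_AE_eq_iff[OF fin sub[OF t] setsN acN ZF'[OF t]])
      show "\<forall>A\<in>sets (F t). emeasure N A = (\<integral>\<^sup>+x\<in>A. ennreal (Z t x) \<partial>M)"
        using NA Zb[OF t] sub[OF t] by (auto simp: subalgebra_def)
    qed
    ultimately show "\<exists>N. ?density N"
      using setsN acN by blast
  qed
qed

section \<open>Martingale measures\<close>

theorem theorem2p1:
  fixes T :: real and I :: "real set" and d :: nat
    and P Q :: "'a measure" and F :: "real \<Rightarrow> 'a measure"
    and X :: "nat \<Rightarrow> real \<Rightarrow> 'a \<Rightarrow> real"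
  assumes "0 < T" and "I \<subseteq> {0..T}" and "{0, T} \<subseteq> I"
    and "prob_space P"
    and "filtration_on I P F"
    and "sets P = sigma_sets (space P) (\<Union>t\<in>I. sets (F t))"
    and "sets (F 0) = sigma_sets (space P) (trivial_events P)"
    and "\<And>i. i \<in> {1..d} \<Longrightarrow> adapted_on I F (X i)"
    and "\<And>i t \<omega>. i \<in> {1..d} \<Longrightarrow> t \<in> I \<Longrightarrow> \<omega> \<in> space P \<Longrightarrow> 0 < X i t \<omega>"
    and "prob_space Q" and "equivalent_measures Q P"
  shows "(\<exists>QQ :: nat \<Rightarrow> 'a measure. \<forall>i\<in>{1..d}.
            prob_space (QQ i) \<and> sets (QQ i) = sets P \<and> absolutely_continuous Q (QQ i) \<and>
            (\<forall>t\<in>I. AE \<omega> in Q.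
               RN_deriv (restr_to_subalg Q (F t)) (restr_to_subalg (QQ i) (F t)) \<omega>
                 = ennreal (X i t \<omega> / X i 0 \<omega>)))
         \<longleftrightarrow> martingale_measure Q I F d X"
proof -
  have sets_Q: "sets Q = sets P" and PQ: "absolutely_continuous P Q"
    using assms(11) by (simp_all add: equivalent_measures_def)
  have space_Q: "space Q = space P"
    by (rule sets_eq_imp_space_eq[OF sets_Q])
  have filt: "filtration_on I Q F"
    using assms(5) by (simp add: filtration_on_def subalgebra_def sets_Q space_Q)
  have I: "0 \<in> I" "T \<in> I" "\<And>t. t \<in> I \<Longrightarrow> 0 \<le> t \<and> t \<le> T"
    using assms(2,3) by auto
  have fin: "finite_measure Q"
    using assms(10) by (rule prob_space.finite_measure)
  have sub0: "subalgebra Q (F 0)"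
    using filt I(1) by (simp add: filtration_on_def)
  have density_iff_martingale:
    "(\<exists>N. prob_space N \<and> sets N = sets P \<and> absolutely_continuous Q N \<and>
        (\<forall>t\<in>I. AE \<omega> in Q. RN_deriv (restr_to_subalg Q (F t)) (restr_to_subalg N (F t)) \<omega>
          = ennreal (X i t \<omega> / X i 0 \<omega>)))
      \<longleftrightarrow> martingale_on Q I F (X i)" if i: "i \<in> {1..d}" for i
  proof -
    have pos: "0 < X i t \<omega>" if "t \<in> I" "\<omega> \<in> space Q" for t \<omega>
      using assms(9)[OF i] that by (simp add: space_Q)
    have adapt: "adapted_on I F (X i)"
      using assms(8)[OF i] .
    have adapt': "adapted_on I F (\<lambda>t \<omega>. X i t \<omega> / X i 0 \<omega>)"
      unfolding adapted_on_def
    proof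
      fix t assume t: "t \<in> I"
      have "subalgebra (F t) (F 0)"
        using filt I(1) I(3)[OF t] t by (auto simp: filtration_on_def subalgebra_def)
      then have "X i 0 \<in> borel_measurable (F t)"
        using adapt I(1) by (auto simp: adapted_on_def intro: measurable_from_subalg)
      moreover have "X i t \<in> borel_measurable (F t)"
        using adapt t by (simp add: adapted_on_def)
      ultimately show "(\<lambda>\<omega>. X i t \<omega> / X i 0 \<omega>) \<in> borel_measurable (F t)"
        by measurable
    qed
    have "\<exists>x0\<in>space Q. AE \<omega> in Q. X i 0 \<omega> = X i 0 x0"
    proof (rule AE_eq_const_if_zero_one[OF assms(10) sub0])
      show "X i 0 \<in> borel_measurable (F 0)"
        using adapt I(1) by (simp add: adapted_on_def)
      show "(AE x in Q. x \<in> A) \<or> (AE x in Q. x \<notin> A)" if "A \<in> sets (F 0)" for A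
        using AE_zero_one_sigma_sets_trivial_events[OF assms(4) PQ sets_Q] that
        unfolding assms(7) .
    qed
    then obtain c where c: "0 < c" "AE \<omega> in Q. X i 0 \<omega> = c"
      using pos[OF I(1)] by blast
    have "AE \<omega> in Q. X i t \<omega> / X i 0 \<omega> = (1 / c) * X i t \<omega>" for t
      using c(2) by eventually_elim simp
    moreover have "AE \<omega> in Q. X i t \<omega> = c * (X i t \<omega> / X i 0 \<omega>)" for t
      using c(2) by eventually_elim (use c(1) in simp)
    ultimately have scale:
      "martingale_on Q I F (\<lambda>t \<omega>. X i t \<omega> / X i 0 \<omega>) \<longleftrightarrow> martingale_on Q I F (X i)"
      using martingale_on_AE_eq_cmult[OF fin filt] adapt adapt' by blast
    have "AE \<omega> in Q. X i 0 \<omega> / X i 0 \<omega> = 1"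
      using c(2) by eventually_elim (use c(1) in simp)
    moreover have "0 \<le> X i t \<omega> / X i 0 \<omega>" if "t \<in> I" "\<omega> \<in> space Q" for t \<omega>
      using pos[OF that] pos[OF I(1) that(2)] by simp
    ultimately show ?thesis
      using ex_measure_with_density_process_iff_martingale[OF assms(10) filt I adapt']
      by (simp add: scale sets_Q)
  qed
  show ?thesis
    unfolding martingale_measure_def
    using density_iff_martingale by (subst bchoice_iff[symmetric]) blast
qed

end
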